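(* Let $W$ be the weight matrix of a connected weighted undirected graph with edge set $\mathcal{E}$, and let $\varepsilon>0$. Let $E(t)$, for $t$ in an open interval $I$, be a differentiable path of $\varepsilon$-feasible matrices, such that the second smallest eigenvalue of $\mathrm{Lap}(W+\varepsilon E(t))$ is simple for all $t\in I$, and which solves the constrained gradient system $\dot E(t)=Z(t)$, as defined in the context. Suppose that the set of cut edges $\mathcal{E}_0(t)=\{(i,j)\in\mathcal{E}: w_{ij}+\varepsilon e_{ij}(t)=0\}$ does not change on $I$, i.e. $\mathcal{E}_0(t)=\mathcal{E}_0$ for all $t\in I$. Let $P^+=P_{\mathcal{E}\setminus\mathcal{E}_0}$, and assume $P^+E(t)\neq 0$ for $t\in I$. Then on $I$ the gradient system becomes (omitting the argument $t$) $$\dot E=-P^+G_\varepsilon(E)-\kappa P^+E\qquad\text{with}\qquad \kappa=\frac{\langle -G_\varepsilon(E),P^+E\rangle}{\|P^+E\|^2}.$$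
   Context: Graph setting: vertex set $\{1,\dots,n\}$; $\mathcal{E}$ is a symmetric set of edges; the weight matrix $W=(w_{ij})$ satisfies $w_{ij}=w_{ji}\ge 0$ for $(i,j)\in\mathcal{E}$ and $w_{ij}=0$ for $(i,j)\notin\mathcal{E}$. The graph is connected if any two vertices are joined by a path of edges with positive weights. Notation: $\mathbf{1}=(1,\dots,1)^T\in\mathbb{R}^n$; $\langle X,Y\rangle=\mathrm{trace}(X^TY)$ and $\|\cdot\|$ are the Frobenius inner product and norm; $\mathrm{Sym}(A)=\tfrac12(A+A^T)$; $x^2=(x_i^2)$ is the entrywise square. $\mathrm{Lap}(W)=\mathrm{diag}(W\mathbf{1})-W$. For a set of edges $\mathcal{F}$, $P_{\mathcal{F}}(A)$ is the matrix with entries $a_{ij}$ for $(i,j)\in\mathcal{F}$ and $0$ otherwise. A matrix $E$ is $\varepsilon$-feasible if $\|E\|=1$, $E=E^T$, $E=P_{\mathcal{E}}(E)$ and $W+\varepsilon E\ge 0$ entrywise. For an $\varepsilon$-feasible $E$ such that the second smallest eigenvalue of $\mathrm{Lap}(W+\varepsilon E)$ is simple, with unit eigenvector $x$, set $G_\varepsilon(E)=P_{\mathcal{E}}(\mathrm{Sym}(x^2\mathbf{1}^T)-xx^T)$. Constrained gradient system: $\dot E(t)=Z(t)$, where for each $t$ the matrix $Z=Z(t)=(z_{ij})$ satisfies, with $E=E(t)$, $G=G_\varepsilon(E(t))$ and $\mathcal{E}_0=\mathcal{E}_0(t)$, the constraints (i') $\langle E,Z\rangle=0$; (ii') $Z$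 is symmetric; (iii') $Z=P_{\mathcal{E}}(Z)$; (iv') $z_{ij}\ge 0$ for all $(i,j)\in\mathcal{E}_0$; and the Karush--Kuhn--Tucker conditions: there are real multipliers $\kappa$ and $\mu_{ij}$, $(i,j)\in\mathcal{E}_0$, with $$Z=-G-\kappa E+\sum_{(i,j)\in\mathcal{E}_0}\mu_{ij}e_ie_j^T,\qquad \mu_{ij}z_{ij}=0,\quad \mu_{ij}\ge 0\quad\text{for all }(i,j)\in\mathcal{E}_0,$$ where $e_i$ denotes the $i$th standard unit vector of $\mathbb{R}^n$ (not to be confused with the entries $e_{ij}$ of $E$). *)

theory Defs
  imports "HOL-Analysis.Analysis" "HOL-Computational_Algebra.Polynomial"
begin

section \<open>Weighted graphs and matrices\<close>

text \<open>
  The vertex set is the finite type \<open>'n\<close>, so \<open>n = CARD('n)\<close>. On \<open>real ^ 'n ^ 'n\<close> the library's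
  \<open>\<bullet>\<close> and \<open>norm\<close> are the Frobenius inner product and norm (\<open>inner_eq_trace\<close> below), not the
  operator norm.
\<close>

definition is_weight_matrix :: "('n::finite \<times> 'n) set \<Rightarrow> real ^ 'n ^ 'n \<Rightarrow> bool" where
  "is_weight_matrix \<E> W \<longleftrightarrow> sym \<E> \<and>
     (\<forall>i j. (i, j) \<in> \<E> \<longrightarrow> W $ i $ j = W $ j $ i \<and> W $ i $ j \<ge> 0) \<and>
     (\<forall>i j. (i, j) \<notin> \<E> \<longrightarrow> W $ i $ j = 0)"

definition connected_graph :: "('n::finite \<times> 'n) set \<Rightarrow> real ^ 'n ^ 'n \<Rightarrow> bool" where
  "connected_graph \<E> W \<longleftrightarrow> (\<forall>i j. (i, j) \<in> {(k, l). (k, l) \<in> \<E> \<and> W $ k $ l > 0}\<^sup>*)"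

definition diag_mat :: "real ^ 'n \<Rightarrow> real ^ 'n ^ 'n::finite" where
  "diag_mat d = (\<chi> i j. if i = j then d $ i else 0)"

definition outer :: "real ^ 'n \<Rightarrow> real ^ 'n \<Rightarrow> real ^ 'n ^ 'n::finite" where
  "outer x y = (\<chi> i j. x $ i * y $ j)"

definition sym_part :: "real ^ 'n ^ 'n \<Rightarrow> real ^ 'n ^ 'n::finite" where
  "sym_part A = (1/2) *\<^sub>R (A + transpose A)"

text \<open>The numeral \<open>1 :: real ^ 'n\<close> is the vector all of whose entries are 1.\<close>

definition Lap :: "real ^ 'n ^ 'n \<Rightarrow> real ^ 'n ^ 'n::finite" where
  "Lap W = diag_mat (W *v 1) - W"

definition edge_proj :: "('n::finite \<times> 'n) set \<Rightarrow> real ^ 'n ^ 'n \<Rightarrow> real ^ 'n ^ 'n" where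
  "edge_proj F A = (\<chi> i j. if (i, j) \<in> F then A $ i $ j else 0)"

lemma inner_eq_trace: "X \<bullet> Y = trace (transpose X ** Y)"
  for X Y :: "real ^ 'n ^ 'n"
  unfolding trace_def inner_vec_def matrix_matrix_mult_def transpose_def
  by (simp, rule sum.swap)

section \<open>The second smallest eigenvalue\<close>

definition charpoly :: "real ^ 'n ^ 'n::finite \<Rightarrow> real poly" where
  "charpoly A = det (mat [:0, 1:] - map_matrix (\<lambda>a. [:a:]) A)"

text \<open>Eigenvalues are listed in increasing order and repeated according to multiplicity.\<close>

definition eigenvalues :: "real ^ 'n ^ 'n::finite \<Rightarrow> real list" where
  "eigenvalues A = sorted_list_of_multiset (proots (charpoly A))"

definition second_eigenvalue :: "real ^ 'n ^ 'n::finite \<Rightarrow> real" where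
  "second_eigenvalue A = eigenvalues A ! 1"

definition second_eigenvalue_simple :: "real ^ 'n ^ 'n::finite \<Rightarrow> bool" where
  "second_eigenvalue_simple A \<longleftrightarrow>
     length (eigenvalues A) \<ge> 2 \<and> order (second_eigenvalue A) (charpoly A) = 1"

definition unit_eigenvector :: "real ^ 'n ^ 'n::finite \<Rightarrow> real \<Rightarrow> real ^ 'n \<Rightarrow> bool" where
  "unit_eigenvector A l x \<longleftrightarrow> norm x = 1 \<and> A *v x = l *\<^sub>R x"

section \<open>The gradient and the constrained gradient system\<close>

definition feasible :: "real ^ 'n ^ 'n \<Rightarrow> ('n::finite \<times> 'n) set \<Rightarrow> real \<Rightarrow> real ^ 'n ^ 'n \<Rightarrow> bool" where
  "feasible W \<E> \<epsilon> E \<longleftrightarrow> norm E = 1 \<and> E = transpose E \<and> E = edge_proj \<E> E \<and>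
     (\<forall>i j. (W + \<epsilon> *\<^sub>R E) $ i $ j \<ge> 0)"

definition cut_edges ::
  "real ^ 'n ^ 'n \<Rightarrow> ('n::finite \<times> 'n) set \<Rightarrow> real \<Rightarrow> real ^ 'n ^ 'n \<Rightarrow> ('n \<times> 'n) set" where
  "cut_edges W \<E> \<epsilon> E = {(i, j). (i, j) \<in> \<E> \<and> W $ i $ j + \<epsilon> * E $ i $ j = 0}"

definition grad_of :: "('n::finite \<times> 'n) set \<Rightarrow> real ^ 'n \<Rightarrow> real ^ 'n ^ 'n" where
  "grad_of \<E> x = edge_proj \<E> (sym_part (outer (\<chi> i. (x $ i)\<^sup>2) 1) - outer x x)"

text \<open>
  The unit eigenvector is determined up to its sign when the eigenvalue is simple, and then
  the gradient does not depend on the choice; see \<open>grad_G_eq_grad_of\<close> below.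
\<close>

definition grad_G :: "real ^ 'n ^ 'n \<Rightarrow> ('n::finite \<times> 'n) set \<Rightarrow> real \<Rightarrow> real ^ 'n ^ 'n \<Rightarrow> real ^ 'n ^ 'n" where
  "grad_G W \<E> \<epsilon> E = (let L = Lap (W + \<epsilon> *\<^sub>R E)
     in grad_of \<E> (SOME x. unit_eigenvector L (second_eigenvalue L) x))"

text \<open>
  Constraints and Karush--Kuhn--Tucker conditions on \<open>Z\<close> with multipliers \<open>\<kappa>\<close> and \<open>\<mu>\<close>;
  the values of \<open>\<mu>\<close> outside the cut edges are irrelevant.
\<close>

definition constrained_gradient ::
  "real ^ 'n ^ 'n \<Rightarrow> ('n::finite \<times> 'n) set \<Rightarrow> real \<Rightarrow> real ^ 'n ^ 'n \<Rightarrow> real ^ 'n ^ 'n \<Rightarrow>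
   real \<Rightarrow> ('n \<Rightarrow> 'n \<Rightarrow> real) \<Rightarrow> bool" where
  "constrained_gradient W \<E> \<epsilon> E Z \<kappa> \<mu> \<longleftrightarrow>
     (let \<E>0 = cut_edges W \<E> \<epsilon> E in
       E \<bullet> Z = 0 \<and> Z = transpose Z \<and> Z = edge_proj \<E> Z \<and>
       (\<forall>(i, j) \<in> \<E>0. Z $ i $ j \<ge> 0) \<and>
       Z = - grad_G W \<E> \<epsilon> E - \<kappa> *\<^sub>R E + (\<Sum>(i, j) \<in> \<E>0. \<mu> i j *\<^sub>R outer (axis i 1) (axis j 1)) \<and>
       (\<forall>(i, j) \<in> \<E>0. \<mu> i j * Z $ i $ j = 0 \<and> \<mu> i j \<ge> 0))"

section \<open>Well-definedness of the gradient\<close>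

lemma poly_det: "poly (det M) t = det (map_matrix (\<lambda>p. poly p t) M)"
  for M :: "real poly ^ 'n ^ 'n"
  by (simp add: det_def poly_sum poly_prod)

lemma poly_charpoly: "poly (charpoly A) t = det (mat t - A)"
  unfolding charpoly_def poly_det
  by (rule arg_cong[where f = det]) (simp add: vec_eq_iff mat_def)

lemma mat_mult_vec: "(mat t :: real ^ 'n ^ 'n) *v x = t *\<^sub>R x"
  by (simp add: vec_eq_iff matrix_vector_mult_def mat_def if_distrib[of "\<lambda>a. a * _"] cong: if_cong)

lemma charpoly_nonzero: "charpoly A \<noteq> 0"
  for A :: "real ^ 'n ^ 'n"
proof
  assume "charpoly A = 0"
  then have sing: "det (mat t - A) = 0" for t
    using poly_charpoly[of A t] by simp
  obtain K where K: "\<And>x. norm (A *v x) \<le> norm x * K"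
    using bounded_linear.bounded[OF matrix_vector_mul_bounded_linear[of A]] by blast
  have "\<not> invertible (mat (\<bar>K\<bar> + 1) - A)"
    using sing invertible_det_nz by blast
  then obtain x where x: "x \<noteq> 0" "(mat (\<bar>K\<bar> + 1) - A) *v x = 0"
    using invertible_left_inverse matrix_left_invertible_ker by blast
  then have "A *v x = (\<bar>K\<bar> + 1) *\<^sub>R x"
    by (simp add: matrix_vector_mult_diff_rdistrib mat_mult_vec)
  then have "(\<bar>K\<bar> + 1) * norm x \<le> K * norm x"
    using K[of x] by (simp add: mult.commute)
  moreover have "K < \<bar>K\<bar> + 1" "norm x > 0"
    using x(1) by auto
  ultimately show False
    by simp
qed

lemma ex_unit_eigenvector:
  assumes "second_eigenvalue_simple A"
  shows "\<exists>x. unit_eigenvector A (second_eigenvalue A) x"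
proof -
  let ?l = "second_eigenvalue A"
  have "poly (charpoly A) ?l = 0"
    using assms order_root[of "charpoly A" ?l] unfolding second_eigenvalue_simple_def by simp
  then have "\<not> invertible (mat ?l - A)"
    using invertible_det_nz poly_charpoly by metis
  then obtain x where x: "x \<noteq> 0" "(mat ?l - A) *v x = 0"
    using invertible_left_inverse matrix_left_invertible_ker by blast
  then have "A *v x = ?l *\<^sub>R x"
    by (simp add: matrix_vector_mult_diff_rdistrib mat_mult_vec)
  then have "unit_eigenvector A ?l ((1 / norm x) *\<^sub>R x)"
    using x(1) by (simp add: unit_eigenvector_def matrix_vector_mult_scaleR)
  then show ?thesis ..
qed

lemma eigenvector_simple_parallel:
  fixes A :: "real ^ 'n ^ 'n"
  assumes ord: "order l (charpoly A) = 1"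
    and x: "A *v x = l *\<^sub>R x" and y: "A *v y = l *\<^sub>R y" and k: "x $ k \<noteq> 0"
  shows "y = (y $ k / x $ k) *\<^sub>R x"
proof (rule ccontr)
  define z where "z = y - (y $ k / x $ k) *\<^sub>R x"
  assume "\<not> ?thesis"
  then have "z \<noteq> 0"
    by (simp add: z_def)
  then obtain m where m: "z $ m \<noteq> 0"
    by (metis vec_eq_iff zero_index)
  have zk: "z $ k = 0"
    using k by (simp add: z_def)
  have z: "A *v z = l *\<^sub>R z"
    using x y by (simp add: z_def matrix_vector_mult_diff_distrib matrix_vector_mult_scaleR
        scaleR_right_diff_distrib)
  define Q :: "real poly" where
    "Q = det (\<chi> i j. if j = m then [:z $ i:] else if j = k then [:x $ i:]
                 else (mat [:0, 1:] - map_matrix (\<lambda>a. [:a:]) A) $ i $ j)"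
  have "z $ m * (x $ k * det (mat t - A)) = (t - l)\<^sup>2 * poly Q t" for t
  proof -
    define M where "M = mat t - A"
    define N where "N = (\<chi> i j. if j = k then x $ i else M $ i $ j)"
    have Mx: "M *v x = (t - l) *\<^sub>R x" and Mz: "M *v z = (t - l) *\<^sub>R z"
      using x z by (simp_all add: M_def matrix_vector_mult_diff_rdistrib mat_mult_vec
          scaleR_left_diff_distrib)
    have scale: "det (\<chi> i j. if j = a then (c *\<^sub>R v) $ i else B $ i $ j)
        = c * det (\<chi> i j. if j = a then v $ i else B $ i $ j)"
      for c a and v :: "real ^ 'n" and B :: "real ^ 'n ^ 'n"
    proof -
      have tr: "det (\<chi> i j. if j = a then w $ i else B $ i $ j)
          = det (\<chi> i. if i = a then w else column i B)" for w :: "real ^ 'n"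
        by (subst det_transpose[symmetric], rule arg_cong[where f = det])
          (simp add: vec_eq_iff transpose_def column_def)
      show ?thesis
        unfolding tr scalar_mult_eq_scaleR[symmetric] by (rule det_row_mul)
    qed
    have "x $ k * det M = det (\<chi> i j. if j = k then (M *v x) $ i else M $ i $ j)"
      by (rule cramer_lemma[symmetric])
    also have "\<dots> = (t - l) * det N"
      unfolding Mx N_def by (rule scale)
    finally have 1: "x $ k * det M = (t - l) * det N" .
    have "N *v z = M *v z"
      unfolding vec_eq_iff matrix_vector_mult_def N_def using zk
      by (auto intro!: sum.cong)
    then have Nz: "N *v z = (t - l) *\<^sub>R z"
      using Mz by simp
    have "z $ m * det N = det (\<chi> i j. if j = m then (N *v z) $ i else N $ i $ j)"
      by (rule cramer_lemma[symmetric])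
    also have "\<dots> = (t - l) * det (\<chi> i j. if j = m then z $ i else N $ i $ j)"
      unfolding Nz by (rule scale)
    also have "det (\<chi> i j. if j = m then z $ i else N $ i $ j) = poly Q t"
      unfolding Q_def poly_det
      by (rule arg_cong[where f = det]) (simp add: vec_eq_iff N_def M_def mat_def)
    finally have 2: "z $ m * det N = (t - l) * poly Q t" .
    show ?thesis
      unfolding M_def[symmetric] 1 mult.left_commute[of "z $ m"] 2
      by (simp add: power2_eq_square mult.assoc)
  qed
  then have "poly (smult (z $ m * x $ k) (charpoly A)) t = poly ([:- l, 1:] ^ 2 * Q) t" for t
    by (simp add: poly_charpoly mult.assoc)
  then have "smult (z $ m * x $ k) (charpoly A) = [:- l, 1:] ^ 2 * Q"
    by (simp add: poly_eq_poly_eq_iff[symmetric] fun_eq_iff)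
  then have "[:- l, 1:] ^ 2 dvd smult (z $ m * x $ k) (charpoly A)"
    by simp
  then have "[:- l, 1:] ^ 2 dvd charpoly A"
    using m k by (simp add: dvd_smult_iff)
  then have "2 \<le> order l (charpoly A)"
    using charpoly_nonzero[of A] by (simp add: order_divides)
  with ord show False
    by simp
qed

lemma unit_eigenvector_unique:
  assumes "second_eigenvalue_simple A"
    and x: "unit_eigenvector A (second_eigenvalue A) x"
    and y: "unit_eigenvector A (second_eigenvalue A) y"
  shows "y = x \<or> y = - x"
proof -
  have "x \<noteq> 0"
    using x by (auto simp: unit_eigenvector_def)
  then obtain k where "x $ k \<noteq> 0"
    by (metis vec_eq_iff zero_index)
  then obtain c where c: "y = c *\<^sub>R x"
    using eigenvector_simple_parallel[of "second_eigenvalue A" A x y k] assms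
    unfolding second_eigenvalue_simple_def unit_eigenvector_def by blast
  then have "\<bar>c\<bar> = 1"
    using x y by (simp add: unit_eigenvector_def)
  then show ?thesis
    using c by (auto simp: abs_if split: if_splits)
qed

lemma grad_G_eq_grad_of:
  assumes "second_eigenvalue_simple (Lap (W + \<epsilon> *\<^sub>R E))"
    and "unit_eigenvector (Lap (W + \<epsilon> *\<^sub>R E)) (second_eigenvalue (Lap (W + \<epsilon> *\<^sub>R E))) x"
  shows "grad_G W \<E> \<epsilon> E = grad_of \<E> x"
proof -
  let ?L = "Lap (W + \<epsilon> *\<^sub>R E)"
  let ?y = "SOME y. unit_eigenvector ?L (second_eigenvalue ?L) y"
  have "unit_eigenvector ?L (second_eigenvalue ?L) ?y"
    using assms(2) by (rule someI)
  then have "?y = x \<or> ?y = - x"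
    by (rule unit_eigenvector_unique[OF assms])
  moreover have "grad_of \<E> (- x) = grad_of \<E> x"
    by (simp add: grad_of_def outer_def)
  ultimately show ?thesis
    unfolding grad_G_def Let_def by metis
qed

end

(* On the cut edges the entries of E(t) are constantly -w_ij / eps, so the corresponding entries
   of Z vanish and Z = P+ Z. Applying P+ to the KKT equation removes the multipliers mu, and
   pairing the result with E, using <E, Z> = 0, determines kappa. *)
theory Submission
  imports Defs
begin

lemma edge_proj_nth: "edge_proj F A $ i $ j = (if (i, j) \<in> F then A $ i $ j else 0)"
  by (simp add: edge_proj_def)

lemma edge_proj_diff: "edge_proj F (A - B) = edge_proj F A - edge_proj F B"
  by (simp add: vec_eq_iff edge_proj_nth)

lemma edge_proj_add: "edge_proj F (A + B) = edge_proj F A + edge_proj F B"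
  by (simp add: vec_eq_iff edge_proj_nth)

lemma edge_proj_minus: "edge_proj F (- A) = - edge_proj F A"
  by (simp add: vec_eq_iff edge_proj_nth)

lemma edge_proj_scaleR: "edge_proj F (c *\<^sub>R A) = c *\<^sub>R edge_proj F A"
  by (simp add: vec_eq_iff edge_proj_nth)

text \<open>Masking by \<open>F\<close> acts entry by entry, and so does the Frobenius product;
  hence it does not matter which factor is masked. This self-adjointness moves the projection
  between \<open>E\<close> and \<open>Z\<close> or \<open>G\<close>.\<close>

lemma inner_edge_proj: "edge_proj F A \<bullet> B = A \<bullet> edge_proj F B"
  unfolding inner_vec_def by (intro sum.cong refl) (simp add: edge_proj_nth)

lemma edge_proj_idem: "edge_proj F (edge_proj F A) = edge_proj F A"
  by (simp add: vec_eq_iff edge_proj_nth)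

text \<open>Each summand has its only possibly nonzero entry at its own index pair, which lies in
  \<open>S\<close> and is therefore masked out by \<open>F\<close>. For \<open>S = \<E>0\<close>
  this disposes of the multiplier term.\<close>

lemma edge_proj_sum_units_eq_0:
  assumes "F \<inter> S = {}"
  shows "edge_proj F (\<Sum>(k, l) \<in> S. m k l *\<^sub>R outer (axis k 1) (axis l 1)) = 0"
proof -
  have "(\<Sum>(k, l) \<in> S. m k l *\<^sub>R outer (axis k 1) (axis l 1)) $ i $ j = 0" if "(i, j) \<notin> S" for i j
    using that by (auto simp: outer_def axis_def intro!: sum.neutral)
  then show ?thesis
    using assms by (auto simp: vec_eq_iff edge_proj_nth)
qed

text \<open>Since \<open>I\<close> is open, the entry agrees with a constant function on a
  neighbourhood of \<open>t\<close>, and derivatives at a point are unique.\<close>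

lemma vector_derivative_entry_eq_0:
  fixes E :: "real \<Rightarrow> real ^ 'n ^ 'm"
  assumes "open I" and "t \<in> I" and deriv: "(E has_vector_derivative D) (at t)"
    and const: "\<And>s. s \<in> I \<Longrightarrow> E s $ i $ j = c"
  shows "D $ i $ j = 0"
proof -
  have "((\<lambda>s. E s $ i $ j) has_vector_derivative D $ i $ j) (at t)"
    by (intro bounded_linear.has_vector_derivative[OF bounded_linear_vec_nth] deriv)
  moreover have "((\<lambda>s. E s $ i $ j) has_vector_derivative 0) (at t)"
    by (rule has_vector_derivative_transform_within_open[OF has_vector_derivative_const[of c] assms(1,2)])
      (simp add: const)
  ultimately show ?thesis
    by (rule vector_derivative_unique_at)
qed

theorem lemma3p3:
  fixes \<E> \<E>0 :: "('n::finite \<times> 'n) set" and W :: "real ^ 'n ^ 'n" and \<epsilon> :: real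
    and I :: "real set" and E Z :: "real \<Rightarrow> real ^ 'n ^ 'n"
    and \<kappa> :: "real \<Rightarrow> real" and \<mu> :: "real \<Rightarrow> 'n \<Rightarrow> 'n \<Rightarrow> real"
  assumes "is_weight_matrix \<E> W" and "connected_graph \<E> W" and "\<epsilon> > 0"
    and "open I" and "is_interval I"
    and "\<And>t. t \<in> I \<Longrightarrow> feasible W \<E> \<epsilon> (E t)"
    and "\<And>t. t \<in> I \<Longrightarrow> second_eigenvalue_simple (Lap (W + \<epsilon> *\<^sub>R E t))"
    and "\<And>t. t \<in> I \<Longrightarrow> (E has_vector_derivative Z t) (at t)"
    and "\<And>t. t \<in> I \<Longrightarrow> constrained_gradient W \<E> \<epsilon> (E t) (Z t) (\<kappa> t) (\<mu> t)"
    and "\<And>t. t \<in> I \<Longrightarrow> cut_edges W \<E> \<epsilon> (E t) = \<E>0"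
    and "\<And>t. t \<in> I \<Longrightarrow> edge_proj (\<E> - \<E>0) (E t) \<noteq> 0"
  shows "\<forall>t \<in> I.
    (E has_vector_derivative - edge_proj (\<E> - \<E>0) (grad_G W \<E> \<epsilon> (E t)) - \<kappa> t *\<^sub>R edge_proj (\<E> - \<E>0) (E t)) (at t) \<and>
    \<kappa> t = ((- grad_G W \<E> \<epsilon> (E t)) \<bullet> edge_proj (\<E> - \<E>0) (E t)) / (norm (edge_proj (\<E> - \<E>0) (E t)))\<^sup>2"
proof
  fix t assume t: "t \<in> I"
  define P where "P = edge_proj (\<E> - \<E>0)"
  define G where "G = grad_G W \<E> \<epsilon> (E t)"
  have orth: "E t \<bullet> Z t = 0" and supp: "Z t = edge_proj \<E> (Z t)"
    and kkt: "Z t = - G - \<kappa> t *\<^sub>R E t + (\<Sum>(i, j) \<in> \<E>0. \<mu> t i j *\<^sub>R outer (axis i 1) (axis j 1))"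
    using assms(9)[OF t] unfolding constrained_gradient_def Let_def assms(10)[OF t] G_def by blast+
  \<comment> \<open>The cut set is the same at every time in \<open>I\<close>, so the cut condition
    can be solved for the entry at all \<open>s\<close>, with a value independent of
    \<open>s\<close>.\<close>
  have "Z t $ i $ j = 0" if "(i, j) \<in> \<E>0" for i j
  proof (rule vector_derivative_entry_eq_0[OF \<open>open I\<close> t assms(8)[OF t]])
    fix s assume "s \<in> I"
    then have "W $ i $ j + \<epsilon> * E s $ i $ j = 0"
      using assms(10)[of s] that by (auto simp: cut_edges_def)
    then show "E s $ i $ j = - W $ i $ j / \<epsilon>"
      using \<open>\<epsilon> > 0\<close> by (simp add: field_simps)
  qed
  moreover have "Z t $ i $ j = 0" if "(i, j) \<notin> \<E>" for i j
    using supp that by (metis edge_proj_nth)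
  \<comment> \<open>\<open>Z t\<close> vanishes both on \<open>\<E>0\<close> and off
    \<open>\<E>\<close>, that is, everywhere outside \<open>\<E> - \<E>0\<close>.\<close>
  ultimately have PZ: "P (Z t) = Z t"
    by (auto simp: P_def vec_eq_iff edge_proj_nth)
  have "P (\<Sum>(i, j) \<in> \<E>0. \<mu> t i j *\<^sub>R outer (axis i 1) (axis j 1)) = 0"
    unfolding P_def by (rule edge_proj_sum_units_eq_0) blast
  then have "P (Z t) = - P G - \<kappa> t *\<^sub>R P (E t)"
    by (subst kkt) (simp add: P_def edge_proj_add edge_proj_diff edge_proj_minus edge_proj_scaleR)
  with PZ have Z: "Z t = - P G - \<kappa> t *\<^sub>R P (E t)"
    by simp
  \<comment> \<open>By self-adjointness the projection passes to \<open>Z t\<close>, which it fixes,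
    leaving the orthogonality constraint.\<close>
  have "0 = P (E t) \<bullet> Z t"
    using orth PZ by (simp add: P_def inner_edge_proj)
  also have "\<dots> = - (P (E t) \<bullet> P G) - \<kappa> t * (norm (P (E t)))\<^sup>2"
    unfolding Z by (simp add: inner_diff_right power2_norm_eq_inner)
  \<comment> \<open>Self-adjointness, idempotence and symmetry reduce both sides to
    \<open>E t \<bullet> P G\<close>.\<close>
  also have "P (E t) \<bullet> P G = G \<bullet> P (E t)"
    by (simp only: P_def inner_edge_proj edge_proj_idem inner_commute[of G "edge_proj _ _"])
  finally have "\<kappa> t * (norm (P (E t)))\<^sup>2 = (- G) \<bullet> P (E t)"
    by simp
  \<comment> \<open>Some weight direction survives off the cut edges, so the linear equation for
    \<open>\<kappa> t\<close> has exactly one solution.\<close>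
  moreover have "norm (P (E t)) \<noteq> 0"
    using assms(11)[OF t] by (simp add: P_def)
  ultimately have "\<kappa> t = ((- G) \<bullet> P (E t)) / (norm (P (E t)))\<^sup>2"
    by (metis nonzero_eq_divide_eq power_not_zero)
  with assms(8)[OF t] Z show "(E has_vector_derivative - edge_proj (\<E> - \<E>0) (grad_G W \<E> \<epsilon> (E t))
      - \<kappa> t *\<^sub>R edge_proj (\<E> - \<E>0) (E t)) (at t) \<and>
    \<kappa> t = ((- grad_G W \<E> \<epsilon> (E t)) \<bullet> edge_proj (\<E> - \<E>0) (E t)) / (norm (edge_proj (\<E> - \<E>0) (E t)))\<^sup>2"
    unfolding P_def G_def by metis
qed

end
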